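(* Let $t$ be a monotone aggregation function with $m$ arguments. Let $\mathbf{D}$ be the class of all databases (with $m$ sorted lists). Let $\mathbf{A}$ be the class of all algorithms that correctly find the top $k$ answers for $t$ for every database and that do not make wild guesses. Then the threshold algorithm TA is instance optimal over $\mathbf{A}$ and $\mathbf{D}$.
   Context: Setting: fix positive integers $m$ and $k$ (treated as constants). A database consists of a finite set of $N\ge k$ objects; each object $R$ has $m$ grades (fields) $x_1,\dots,x_m\in[0,1]$. It is presented as $m$ sorted lists $L_1,\dots,L_m$ of length $N$; list $L_i$ contains one entry $(R,x_i)$ for each object $R$, where $x_i$ is the $i$th grade of $R$, in descending order of $x_i$ (the order among ties is part of the database). An aggregation function is a fixed function $t:[0,1]^m\to[0,\infty)$; the overall grade of $R$ is $t(R)=t(x_1,\dots,x_m)$. $t$ is monotone if $t(x_1,\dots,x_m)\le t(x_1',\dots,x_m')$ whenever $x_i\le x_i'$ for every $i$. The top $k$ answers are $k$ objects with the highest overall grades (ties broken arbitrarily), each along with its overall grade. Access and cost: an algorithm obtains information about the database only by sorted access (reading the next entry of some list, proceeding sequentially from the top) and random access (requesting the grade of a given object in a given list, obtained in one step; the object may be one not previously seen). Internal computation is free. With $s$ sorted and $r$ random accesses the middleware cost is $s c_S+r c_R$, where $c_S,c_R>0$ are fixed constants; $cost(\mathcal A,\mathcal D)$ is the middleware cost of algorithm $\mathcal A$ on database $\mathcal D$. An algorithm makes wild guesses if it does random access to find the grade of some object in some list before having seen that object under sorted access. Instance optimality: algorithm $\mathcal B$ is instance optimal over $\mathbf A$ and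 $\mathbf D$ if $\mathcal B\in\mathbf A$ and there are constants $c,c'$ such that $cost(\mathcal B,\mathcal D)\le c\cdot cost(\mathcal A,\mathcal D)+c'$ for every $\mathcal A\in\mathbf A$ and $\mathcal D\in\mathbf D$. Algorithm TA: (1) Do sorted access in parallel to each of the $m$ lists (top entry of each list, then second entry of each list, and so on). As an object $R$ is seen under sorted access in some list, do random access to the other lists to find all its grades, and compute $t(R)$. If this grade is one of the $k$ highest seen, remember $R$ and $t(R)$ (ties broken arbitrarily, only $k$ objects remembered). (2) For each $i$ let $\underline{x}_i$ be the grade of the last object seen under sorted access in $L_i$, and let the threshold value be $\tau=t(\underline{x}_1,\dots,\underline{x}_m)$. As soon as at least $k$ objects have been seen whose grade is at least $\tau$, halt. (3) Output the $k$ seen objects with highest grades, with their grades. *)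

theory Defs
  imports Complex_Main
begin

text \<open>A database is the list of its sorted lists, indexed from \<open>0\<close>; each sorted list holds
  (object, grade) entries, best grade first, so the order among ties is part of the database.\<close>

type_synonym 'o database = "('o \<times> real) list list"

definition objects :: "'o database \<Rightarrow> 'o set" where
  "objects D = (\<Union>L\<in>set D. fst ` set L)"

definition is_database :: "nat \<Rightarrow> nat \<Rightarrow> 'o database \<Rightarrow> bool" where
  "is_database m k D \<longleftrightarrow>
     length D = m \<and> k \<le> card (objects D) \<and>
     (\<forall>L\<in>set D. distinct (map fst L) \<and> fst ` set L = objects D \<and>
        sorted_wrt (\<ge>) (map snd L) \<and> snd ` set L \<subseteq> {0..1})"

definition overall :: "(real list \<Rightarrow> real) \<Rightarrow> 'o database \<Rightarrow> 'o \<Rightarrow> real" where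
  "overall t D R = t (map (\<lambda>L. the (map_of L R)) D)"

definition unit_cube :: "nat \<Rightarrow> real list set" where
  "unit_cube m = {xs. length xs = m \<and> set xs \<subseteq> {0..1}}"

definition aggregation :: "nat \<Rightarrow> (real list \<Rightarrow> real) \<Rightarrow> bool" where
  "aggregation m t \<longleftrightarrow> (\<forall>xs\<in>unit_cube m. 0 \<le> t xs)"

definition monotone_aggregation :: "nat \<Rightarrow> (real list \<Rightarrow> real) \<Rightarrow> bool" where
  "monotone_aggregation m t \<longleftrightarrow>
     (\<forall>xs\<in>unit_cube m. \<forall>ys\<in>unit_cube m. list_all2 (\<le>) xs ys \<longrightarrow> t xs \<le> t ys)"

text \<open>\<open>Y\<close> consists of \<open>k\<close> elements of \<open>S\<close> with the highest grades under \<open>g\<close>,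
  with an arbitrary choice among ties.\<close>

definition is_top :: "nat \<Rightarrow> 'o set \<Rightarrow> ('o \<Rightarrow> real) \<Rightarrow> 'o set \<Rightarrow> bool" where
  "is_top k S g Y \<longleftrightarrow>
     Y \<subseteq> S \<and> card Y = k \<and> (\<forall>R\<in>Y. \<forall>R'\<in>S - Y. g R' \<le> g R)"

text \<open>An algorithm is an arbitrary function from the accesses made so far, together with their
  answers, to the next action; this is all it knows about the database. Sorted access
  to an exhausted list, and random access to an object outside the database, are answered
  by \<open>None\<close>.\<close>

datatype 'o event =
    is_SortedEv: SortedEv nat "('o \<times> real) option"
  | is_RandomEv: RandomEv nat 'o "real option"

datatype 'o action =
    Sorted nat
  | Random nat 'o
  | Halt "('o \<times> real) set"

type_synonym 'o algorithm = "'o event list \<Rightarrow> 'o action"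

definition sorted_entries :: "'o event list \<Rightarrow> nat \<Rightarrow> ('o \<times> real) list" where
  "sorted_entries h i = [e. SortedEv j (Some e) \<leftarrow> h, j = i]"

definition seen :: "'o event list \<Rightarrow> 'o set" where
  "seen h = {R. \<exists>i x. SortedEv i (Some (R, x)) \<in> set h}"

definition next_entry :: "'o database \<Rightarrow> 'o event list \<Rightarrow> nat \<Rightarrow> ('o \<times> real) option" where
  "next_entry D h i =
     (let n = length (sorted_entries h i)
      in if i < length D \<and> n < length (D ! i) then Some (D ! i ! n) else None)"

definition lookup_grade :: "'o database \<Rightarrow> nat \<Rightarrow> 'o \<Rightarrow> real option" where
  "lookup_grade D i R = (if i < length D then map_of (D ! i) R else None)"

inductive run :: "'o algorithm \<Rightarrow> 'o database \<Rightarrow> 'o event list \<Rightarrow> bool"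
  for A :: "'o algorithm" and D :: "'o database" where
  start: "run A D []"
| sorted: "run A D h \<Longrightarrow> A h = Sorted i \<Longrightarrow> run A D (h @ [SortedEv i (next_entry D h i)])"
| random: "run A D h \<Longrightarrow> A h = Random i R \<Longrightarrow> run A D (h @ [RandomEv i R (lookup_grade D i R)])"

definition halts_with ::
    "'o algorithm \<Rightarrow> 'o database \<Rightarrow> 'o event list \<Rightarrow> ('o \<times> real) set \<Rightarrow> bool" where
  "halts_with A D h out \<longleftrightarrow> run A D h \<and> A h = Halt out"

text \<open>A run is deterministic, so the final history is unique if there is one; \<open>cost\<close> is
  meaningful only when \<open>A\<close> halts on \<open>D\<close>, which correctness guarantees.\<close>

definition cost :: "real \<Rightarrow> real \<Rightarrow> 'o algorithm \<Rightarrow> 'o database \<Rightarrow> real" where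
  "cost cS cR A D =
     (let h = (THE h. \<exists>out. halts_with A D h out)
      in real (length (filter is_SortedEv h)) * cS + real (length (filter is_RandomEv h)) * cR)"

definition correct :: "nat \<Rightarrow> nat \<Rightarrow> (real list \<Rightarrow> real) \<Rightarrow> 'o algorithm \<Rightarrow> bool" where
  "correct m k t A \<longleftrightarrow>
     (\<forall>D. is_database m k D \<longrightarrow>
        (\<exists>h Y. is_top k (objects D) (overall t D) Y \<and>
               halts_with A D h ((\<lambda>R. (R, overall t D R)) ` Y)))"

definition no_wild_guesses :: "nat \<Rightarrow> nat \<Rightarrow> 'o algorithm \<Rightarrow> bool" where
  "no_wild_guesses m k A \<longleftrightarrow>
     (\<forall>D h i R. is_database m k D \<and> run A D h \<and> A h = Random i R \<longrightarrow> R \<in> seen h)"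

definition instance_optimal ::
    "real \<Rightarrow> real \<Rightarrow> 'o algorithm set \<Rightarrow> 'o database set \<Rightarrow> 'o algorithm \<Rightarrow> bool" where
  "instance_optimal cS cR \<A> \<D> B \<longleftrightarrow>
     B \<in> \<A> \<and>
     (\<exists>c c'. \<forall>A\<in>\<A>. \<forall>D\<in>\<D>. cost cS cR B D \<le> c * cost cS cR A D + c')"

definition known_grade :: "'o event list \<Rightarrow> 'o \<Rightarrow> nat \<Rightarrow> real" where
  "known_grade h R i =
     (THE x. SortedEv i (Some (R, x)) \<in> set h \<or> RandomEv i R (Some x) \<in> set h)"

definition computed_grade :: "nat \<Rightarrow> (real list \<Rightarrow> real) \<Rightarrow> 'o event list \<Rightarrow> 'o \<Rightarrow> real" where
  "computed_grade m t h R = t (map (known_grade h R) [0..<m])"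

definition threshold :: "nat \<Rightarrow> (real list \<Rightarrow> real) \<Rightarrow> 'o event list \<Rightarrow> real" where
  "threshold m t h = t (map (\<lambda>i. snd (last (sorted_entries h i))) [0..<m])"

text \<open>\<open>pick\<close> resolves the arbitrary tie-breaking among the seen objects.\<close>

definition tie_breaking ::
    "nat \<Rightarrow> nat \<Rightarrow> (real list \<Rightarrow> real) \<Rightarrow> ('o event list \<Rightarrow> 'o set) \<Rightarrow> bool" where
  "tie_breaking m k t pick \<longleftrightarrow>
     (\<forall>h. k \<le> card (seen h) \<longrightarrow> is_top k (seen h) (computed_grade m t h) (pick h))"

text \<open>The history of the threshold algorithm is a sequence of blocks of length \<open>m\<close>: a sorted
  access followed by \<open>m - 1\<close> random accesses for the object just seen, one in each other list
  (also if that object was seen before). Block number \<open>b\<close> starts at position \<open>b * m\<close> and has its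
  sorted access in list \<open>b mod m\<close>, so \<open>m\<close> consecutive blocks form one parallel step. The halting
  condition is evaluated after each parallel step. The final \<open>Halt {}\<close>, for a list that is
  exhausted, is never reached on a database when \<open>t\<close> is monotone.\<close>

definition TA ::
    "nat \<Rightarrow> nat \<Rightarrow> (real list \<Rightarrow> real) \<Rightarrow> ('o event list \<Rightarrow> 'o set) \<Rightarrow> 'o algorithm" where
  "TA m k t pick h =
     (let b = length h div m; j = length h mod m; i = b mod m in
      if j = 0 then
        if 0 < b \<and> i = 0 \<and>
           k \<le> card {R \<in> seen h. threshold m t h \<le> computed_grade m t h R}
        then Halt ((\<lambda>R. (R, computed_grade m t h R)) ` pick h)
        else Sorted i
      else
        (case h ! (b * m) of
           SortedEv _ (Some (R, _)) \<Rightarrow> Random (filter (\<lambda>l. l \<noteq> i) [0..<m] ! (j - 1)) R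
         | _ \<Rightarrow> Halt {}))"

end

theory Submission
  imports Defs
begin

text \<open>Let \<open>A\<close> halt after \<open>s\<close> sorted accesses; then it has seen at most \<open>s\<close> objects and has read no
  list beyond depth \<open>s\<close>. TA halts by depth \<open>s + k\<close>. If there are at most \<open>s + k\<close> objects, the lists
  are exhausted by then. Otherwise consider an object \<open>V\<close> that \<open>A\<close> has not seen. As \<open>A\<close> makes no wild
  guesses, it cannot notice if \<open>V\<close> is moved in every list to any place below the part read, with a
  grade at most the last one read there. Give \<open>V\<close> exactly those last grades: correctness of \<open>A\<close> on
  the changed database forces every object in its output to have overall grade at least \<open>t\<close> of the
  last grades, which is at least the threshold of TA at depth \<open>s + k\<close>.\<close>

subsection \<open>Databases\<close>

locale database =
  fixes m k :: nat and D :: "'o database"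
  assumes m_pos: "0 < m" and k_pos: "0 < k" and db: "is_database m k D"
begin

abbreviation N :: nat where "N \<equiv> card (objects D)"

abbreviation grade :: "nat \<Rightarrow> 'o \<Rightarrow> real" where
  "grade i R \<equiv> the (map_of (D ! i) R)"

lemma length_D: "length D = m"
  using db by (simp add: is_database_def)

lemma k_le_N: "k \<le> N"
  using db by (simp add: is_database_def)

lemma
  assumes "i < m"
  shows distinct_list: "distinct (map fst (D ! i))"
    and objects_list: "fst ` set (D ! i) = objects D"
    and sorted_list: "sorted_wrt (\<ge>) (map snd (D ! i))"
    and range_list: "snd ` set (D ! i) \<subseteq> {0..1}"
  using assms db nth_mem[of i D] unfolding is_database_def by blast+

lemma length_list: "i < m \<Longrightarrow> length (D ! i) = N"
  using distinct_card[OF distinct_list] objects_list by (metis length_map set_map)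

lemma nth_antimono:
  assumes "i < m" "p \<le> q" "q < N"
  shows "snd (D ! i ! q) \<le> snd (D ! i ! p)"
proof (cases "p = q")
  case False
  then show ?thesis
    using assms sorted_wrt_nth_less[OF sorted_list[OF assms(1)], of p q]
    by (simp add: length_list)
qed simp

lemma grade_eq: "i < m \<Longrightarrow> (R, x) \<in> set (D ! i) \<Longrightarrow> map_of (D ! i) R = Some x"
  using distinct_list by (simp add: map_of_is_SomeI)

lemma map_of_grade:
  assumes "i < m" "R \<in> objects D"
  shows "map_of (D ! i) R = Some (grade i R)"
proof -
  have "R \<in> fst ` set (D ! i)" using assms objects_list by blast
  then obtain x where "(R, x) \<in> set (D ! i)" by force
  then show ?thesis using grade_eq[OF assms(1)] by simp
qed

lemma grade_range:
  assumes "i < m" "R \<in> objects D"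
  shows "0 \<le> grade i R" "grade i R \<le> 1"
  using map_of_SomeD[OF map_of_grade[OF assms]] range_list[OF assms(1)] by force+

lemma overall_eq: "overall t D R = t (map (\<lambda>i. grade i R) [0..<m])"
proof -
  have "map (\<lambda>L. the (map_of L R)) D = map (\<lambda>i. grade i R) [0..<m]"
    by (rule nth_equalityI) (auto simp: length_D)
  then show ?thesis by (simp add: overall_def)
qed

lemma snd_nth_range:
  assumes "i < m" "p < N"
  shows "0 \<le> snd (D ! i ! p)" "snd (D ! i ! p) \<le> 1"
  using range_list[OF assms(1)] nth_mem[of p "D ! i"] assms by (force simp: length_list)+

end

lemma monotone_aggregation_map:
  assumes "monotone_aggregation m t"
    and "\<And>i. i < m \<Longrightarrow> 0 \<le> f i \<and> f i \<le> g i \<and> g i \<le> 1"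
  shows "t (map f [0..<m]) \<le> t (map g [0..<m])"
proof -
  have "map f [0..<m] \<in> unit_cube m" "map g [0..<m] \<in> unit_cube m"
    using assms(2) by (force simp: unit_cube_def)+
  moreover have "list_all2 (\<le>) (map f [0..<m]) (map g [0..<m])"
    using assms(2) by (simp add: list_all2_conv_all_nth)
  ultimately show ?thesis using assms(1) by (simp add: monotone_aggregation_def)
qed

subsection \<open>Runs\<close>

lemma sorted_entries_Nil [simp]: "sorted_entries [] i = []"
  by (simp add: sorted_entries_def)

lemma sorted_entries_append [simp]:
  "sorted_entries (h @ h') i = sorted_entries h i @ sorted_entries h' i"
  by (simp add: sorted_entries_def)

lemma sorted_entries_Sorted [simp]:
  "sorted_entries [SortedEv j e] i = (if j = i then (case e of None \<Rightarrow> [] | Some e \<Rightarrow> [e]) else [])"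
  by (simp add: sorted_entries_def split: option.splits)

lemma sorted_entries_Random [simp]: "sorted_entries [RandomEv j R x] i = []"
  by (simp add: sorted_entries_def)

lemma set_sorted_entries: "set (sorted_entries h i) = {e. SortedEv i (Some e) \<in> set h}"
  by (force simp: sorted_entries_def split: event.splits option.splits)

lemma seen_eq: "seen h = (\<Union>i. fst ` set (sorted_entries h i))"
  by (force simp: seen_def set_sorted_entries)

lemma seen_append [simp]: "seen (h @ h') = seen h \<union> seen h'"
  by (auto simp: seen_def)

text \<open>Accesses to other lists and failed accesses are counted on the right only.\<close>

lemma length_sorted_entries_le: "length (sorted_entries h i) \<le> length (filter is_SortedEv h)"
proof (induction h rule: rev_induct)
  case (snoc e h)
  then show ?case by (cases e) (auto split: option.splits)
qed simp

text \<open>Each sorted access reveals at most one new object, and random accesses never enlarge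
  \<open>seen\<close>.\<close>

lemma finite_card_seen: "finite (seen h) \<and> card (seen h) \<le> length (filter is_SortedEv h)"
proof (induction h rule: rev_induct)
  case Nil
  then show ?case by (simp add: seen_def)
next
  case (snoc e h)
  show ?case
  proof (cases "\<exists>i R x. e = SortedEv i (Some (R, x))")
    case True
    then obtain i R x where e: "e = SortedEv i (Some (R, x))" by blast
    have "seen [e] = {R}" by (auto simp: seen_def e)
    then show ?thesis using snoc by (simp add: e card_insert_if)
  next
    case False
    then have "seen [e] = {}" by (auto simp: seen_def)
    then show ?thesis using snoc by simp
  qed
qed

section \<open>Determinism of runs\<close>

definition next_event :: "'o algorithm \<Rightarrow> 'o database \<Rightarrow> 'o event list \<Rightarrow> 'o event option" where
  "next_event A D h =
     (case A h of
        Sorted i \<Rightarrow> Some (SortedEv i (next_entry D h i))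
      | Random i R \<Rightarrow> Some (RandomEv i R (lookup_grade D i R))
      | Halt _ \<Rightarrow> None)"

lemma run_next_event: "run A D h \<Longrightarrow> next_event A D h = Some e \<Longrightarrow> run A D (h @ [e])"
  by (auto simp: next_event_def intro: run.intros split: action.splits)

lemma run_nth:
  assumes "run A D h" "n < length h"
  shows "next_event A D (take n h) = Some (h ! n)"
  using assms
  by induction (auto simp: less_Suc_eq nth_append, auto simp: next_event_def)

text \<open>The next event is a function of the prefix, so two runs of one algorithm on one database
  agree as far as both reach.\<close>

lemma run_take: "run A D h \<Longrightarrow> run A D h' \<Longrightarrow> n \<le> length h \<Longrightarrow> n \<le> length h' \<Longrightarrow> take n h = take n h'"
proof (induction n)
  case (Suc n)
  then have "take n h = take n h'" by simp
  moreover have "h ! n = h' ! n"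
    using run_nth[OF Suc.prems(1), of n] run_nth[OF Suc.prems(2), of n] Suc.prems calculation
    by simp
  ultimately show ?case using Suc.prems by (simp add: take_Suc_conv_app_nth)
qed simp

text \<open>A longer run would continue the halted history, where \<open>next_event\<close> is
  \<open>None\<close>.\<close>

lemma run_Halt_maximal:
  assumes "run A D h" "A h = Halt Z" "run A D h'"
  shows "length h' \<le> length h"
proof (rule ccontr)
  assume less: "\<not> length h' \<le> length h"
  then have "take (length h) h' = h" using run_take[OF assms(1,3), of "length h"] by simp
  then show False using run_nth[OF assms(3), of "length h"] less assms(2)
    by (simp add: next_event_def)
qed

lemma halts_with_unique:
  assumes "halts_with A D h Z" "halts_with A D h' Z'"
  shows "h' = h \<and> Z' = Z"
proof -
  have r: "run A D h" "A h = Halt Z" "run A D h'" "A h' = Halt Z'"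
    using assms by (auto simp: halts_with_def)
  have "length h = length h'"
    using run_Halt_maximal[OF r(1,2,3)] run_Halt_maximal[OF r(3,4,1)] by simp
  then have "h = h'" using run_take[OF r(1,3), of "length h"] by simp
  then show ?thesis using r by simp
qed

lemma cost_eq:
  assumes "halts_with A D h Z"
  shows "cost cS cR A D =
    real (length (filter is_SortedEv h)) * cS + real (length (filter is_RandomEv h)) * cR"
proof -
  have "(THE h. \<exists>Z. halts_with A D h Z) = h"
    using assms halts_with_unique[OF assms] by blast
  then show ?thesis by (simp add: cost_def)
qed

section \<open>Dependence of a run on the database\<close>

lemma run_sorted_entries:
  assumes "run A D h"
  shows "sorted_entries h i = take (length (sorted_entries h i)) (if i < length D then D ! i else [])"
  using assms
proof induction
  case (sorted h j)
  then show ?case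
    by (auto simp: next_entry_def Let_def take_Suc_conv_app_nth split: option.splits if_splits)
qed auto

text \<open>Answers depend only on the list lengths, the entries read and the grades requested.
  Lengths matter because an exhausted list answers \<open>None\<close>.\<close>

lemma run_transfer:
  assumes "run A D h" "length D' = length D"
    and "\<And>i. i < length D \<Longrightarrow> length (D' ! i) = length (D ! i)"
    and "\<And>i. i < length D \<Longrightarrow> take (d i) (D' ! i) = take (d i) (D ! i)"
    and "\<And>i. length (sorted_entries h i) \<le> d i"
    and "\<And>i R x. RandomEv i R x \<in> set h \<Longrightarrow> lookup_grade D' i R = lookup_grade D i R"
  shows "run A D' h"
  using assms(1,5,6)
proof induction
  case start
  show ?case by (rule run.start)
next
  case (sorted h i)
  have "length (sorted_entries h j) \<le> d j" for j
    using sorted.prems(1)[of j] by simp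
  then have run: "run A D' h" using sorted by simp
  have "next_entry D' h i = next_entry D h i"
  proof (cases "i < length D \<and> length (sorted_entries h i) < length (D ! i)")
    case True
    let ?n = "length (sorted_entries h i)"
    \<comment> \<open>The access at depth \<open>?n\<close> succeeds, so the extended history holds
      \<open>Suc ?n\<close> entries of this list.\<close>
    have "?n < d i"
      using sorted.prems(1)[of i] True by (simp add: next_entry_def)
    then have "D' ! i ! ?n = D ! i ! ?n"
      using assms(4)[of i] True by (metis nth_take)
    then show ?thesis using assms(2,3) True by (simp add: next_entry_def Let_def)
  next
    case False
    then show ?thesis using assms(2,3) by (auto simp: next_entry_def Let_def)
  qed
  then show ?case using run.sorted[OF run sorted.hyps(2)] by simp
next
  case (random h i R)
  have "lookup_grade D' j R' = lookup_grade D j R'" if "RandomEv j R' x \<in> set h" for j R' x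
    using random.prems(2)[of j R' x] that by simp
  then have run: "run A D' h" using random by simp
  show ?case using run.random[OF run random.hyps(2)] random.prems(2)[of i R "lookup_grade D i R"] by simp
qed

text \<open>The object is seen when it is requested, and \<open>seen\<close> only grows along a
  run.\<close>

lemma no_wild_guesses_random_seen:
  assumes "no_wild_guesses m k A" "is_database m k D" "run A D h" "RandomEv i R x \<in> set h"
  shows "R \<in> seen h"
  using assms(3,4)
proof induction
  case (random h j R')
  then show ?case using assms(1,2) by (auto simp: no_wild_guesses_def)
qed auto


subsection \<open>Lowering an unseen object\<close>

text \<open>The tail is re-sorted instead of inserting \<open>V\<close> at a computed position; the
  key is negated because grades descend while \<open>sort_key\<close> ascends.\<close>

definition lower_list :: "nat \<Rightarrow> ('o \<times> real) list \<Rightarrow> 'o \<Rightarrow> real \<Rightarrow> ('o \<times> real) list" where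
  "lower_list d L V x =
     take d L @ sort_key (\<lambda>e. - snd e) ((V, x) # filter (\<lambda>e. fst e \<noteq> V) (drop d L))"

lemma set_lower_list:
  assumes "V \<notin> fst ` set (take d L)"
  shows "set (lower_list d L V x) = insert (V, x) {e \<in> set L. fst e \<noteq> V}"
proof -
  have "set L = set (take d L) \<union> set (drop d L)"
    by (metis append_take_drop_id set_append)
  moreover have "e \<in> set (take d L) \<Longrightarrow> fst e \<noteq> V" for e using assms by force
  ultimately show ?thesis by (auto simp: lower_list_def simp del: sort_key_simps)
qed

lemma distinct_lower_list:
  assumes "distinct (map fst L)" "V \<notin> fst ` set (take d L)"
  shows "distinct (map fst (lower_list d L V x))"
proof -
  have L: "distinct (map fst (take d L))" "distinct (map fst (drop d L))"
    "fst ` set (take d L) \<inter> fst ` set (drop d L) = {}"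
    using assms(1) append_take_drop_id[of d L] by (metis distinct_append map_append set_map)+
  have "distinct (map fst ((V, x) # filter (\<lambda>e. fst e \<noteq> V) (drop d L)))"
    using L(2) by (auto simp: distinct_map_filter)
  then have "distinct (map fst
      (sort_key (\<lambda>e. - snd e) ((V, x) # filter (\<lambda>e. fst e \<noteq> V) (drop d L))))"
    by (simp only: distinct_map distinct_sort set_sort)
  then show ?thesis using L(1,3) assms(2) 
    by (auto simp: lower_list_def simp del: sort_key_simps)
qed

text \<open>Only the junction matters: the kept prefix dominates the old tail by the order of
  \<open>L\<close>, and the new grade \<open>x\<close> by assumption.\<close>

lemma sorted_lower_list:
  assumes "sorted_wrt (\<ge>) (map snd L)" "\<And>e. e \<in> set (take d L) \<Longrightarrow> x \<le> snd e"
  shows "sorted_wrt (\<ge>) (map snd (lower_list d L V x))"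
proof -
  have "sorted_wrt (\<ge>) (map snd (take d L) @ map snd (drop d L))"
    using assms(1) by (metis append_take_drop_id map_append)
  then have L: "sorted_wrt (\<ge>) (map snd (take d L))"
    "\<And>e e'. e \<in> set (take d L) \<Longrightarrow> e' \<in> set (drop d L) \<Longrightarrow> snd e' \<le> snd e"
    by (auto simp: sorted_wrt_append)
  have "sorted (map (\<lambda>e. - snd e) (sort_key (\<lambda>e. - snd e) ys))" for ys :: "('a \<times> real) list"
    by (rule sorted_sort_key)
  then have "sorted_wrt (\<ge>) (map snd (sort_key (\<lambda>e. - snd e) ys))" for ys :: "('a \<times> real) list"
    by (simp add: sorted_wrt_map)
  then show ?thesis using L assms(2) 
    by (auto simp: lower_list_def sorted_wrt_append simp del: sort_key_simps)
qed

section \<open>Grades at the reading depth\<close>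

context database
begin

text \<open>In a list where nothing has been read, the best known bound on the grades is \<open>1\<close>.\<close>

definition bottom :: "'o event list \<Rightarrow> nat \<Rightarrow> real" where
  "bottom h i = (if sorted_entries h i = [] then 1 else snd (last (sorted_entries h i)))"

lemma sorted_entries_take:
  "run A D h \<Longrightarrow> i < m \<Longrightarrow>
    sorted_entries h i = take (length (sorted_entries h i)) (D ! i)"
  using run_sorted_entries[of A D h i] by (simp add: length_D)

lemma length_sorted_entries_le_N:
  "run A D h \<Longrightarrow> i < m \<Longrightarrow> length (sorted_entries h i) \<le> N"
  using sorted_entries_take[of A h i]
  by (metis length_list length_take min.cobounded1)

lemma bottom_eq:
  assumes "run A D h" "i < m" "sorted_entries h i \<noteq> []"
  shows "bottom h i = snd (D ! i ! (length (sorted_entries h i) - 1))"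
proof -
  have "last (sorted_entries h i) = D ! i ! (length (sorted_entries h i) - 1)"
    using assms sorted_entries_take[OF assms(1,2)]
    by (metis diff_less last_conv_nth length_greater_0_conv nth_take zero_less_one)
  then show ?thesis using assms by (simp add: bottom_def)
qed

lemma bottom_range:
  assumes "run A D h" "i < m"
  shows "0 \<le> bottom h i" "bottom h i \<le> 1"
proof -
  have "0 \<le> bottom h i \<and> bottom h i \<le> 1"
  proof (cases "sorted_entries h i = []")
    case False
    then have "length (sorted_entries h i) - 1 < N"
      using length_sorted_entries_le_N[OF assms]
      by (cases "sorted_entries h i") auto
    then show ?thesis using snd_nth_range[OF assms(2)] bottom_eq[OF assms False] by simp
  qed (simp add: bottom_def)
  then show "0 \<le> bottom h i" "bottom h i \<le> 1" by auto
qed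

lemma bottom_le:
  assumes "run A D h" "i < m" "e \<in> set (sorted_entries h i)"
  shows "bottom h i \<le> snd e"
proof -
  let ?n = "length (sorted_entries h i)"
  obtain p where p: "p < ?n" "e = sorted_entries h i ! p"
    using assms(3) by (metis in_set_conv_nth)
  have "e = D ! i ! p" using p sorted_entries_take[OF assms(1,2)] by (metis nth_take)
  moreover have "snd (D ! i ! (?n - 1)) \<le> snd (D ! i ! p)"
    using p(1) length_sorted_entries_le_N[OF assms(1,2)]
    by (intro nth_antimono[OF assms(2)]) auto
  ultimately show ?thesis using bottom_eq[OF assms(1,2)] assms(3) by force
qed

text \<open>The grades \<open>w\<close> are a parameter since two choices are compared later: the
  bottom grades and the constant \<open>0\<close>.\<close>

definition lower :: "'o event list \<Rightarrow> 'o \<Rightarrow> (nat \<Rightarrow> real) \<Rightarrow> 'o database" where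
  "lower h V w =
     map (\<lambda>i. lower_list (length (sorted_entries h i)) (D ! i) V (w i)) [0..<m]"

section \<open>The database with a lowered object\<close>

context
  fixes A :: "'o algorithm" and h V and w :: "nat \<Rightarrow> real"
  assumes run: "run A D h" and V: "V \<in> objects D" "V \<notin> seen h"
    and w: "\<And>i. i < m \<Longrightarrow> 0 \<le> w i \<and> w i \<le> bottom h i"
begin

lemma V_notin_prefix: "i < m \<Longrightarrow> V \<notin> fst ` set (take (length (sorted_entries h i)) (D ! i))"
  using V(2) sorted_entries_take[OF run] by (auto simp: seen_eq)

lemma set_lower_nth: "i < m \<Longrightarrow> set (lower h V w ! i) = insert (V, w i) {e \<in> set (D ! i). fst e \<noteq> V}"
  using set_lower_list[OF V_notin_prefix] by (simp add: lower_def)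

lemma fst_set_lower_nth: "i < m \<Longrightarrow> fst ` set (lower h V w ! i) = objects D"
proof -
  assume i: "i < m"
  have "fst ` set (lower h V w ! i) = insert V (fst ` set (D ! i) - {V})"
    unfolding set_lower_nth[OF i] by force
  then show ?thesis using objects_list[OF i] V(1) by auto
qed

lemma length_lower: "length (lower h V w) = m"
  by (simp add: lower_def)

lemma objects_lower: "objects (lower h V w) = objects D"
proof -
  have "objects (lower h V w) = (\<Union>i<m. fst ` set (lower h V w ! i))"
    by (simp add: objects_def set_conv_nth[of "lower h V w"] length_lower) auto
  then show ?thesis using fst_set_lower_nth m_pos by auto
qed

lemma distinct_lower_nth: "i < m \<Longrightarrow> distinct (map fst (lower h V w ! i))"
  using distinct_lower_list[OF distinct_list V_notin_prefix] by (simp add: lower_def)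

text \<open>The bound by \<open>bottom\<close> serves twice: \<open>V\<close> does not exceed any
  entry already read, and its grades stay at most \<open>1\<close>.\<close>

lemma is_database_lower: "is_database m k (lower h V w)"
proof -
  have "sorted_wrt (\<ge>) (map snd (lower h V w ! i))" if "i < m" for i
  proof -
    have "w i \<le> snd e" if "e \<in> set (take (length (sorted_entries h i)) (D ! i))" for e
      using that \<open>i < m\<close> sorted_entries_take[OF run \<open>i < m\<close>] bottom_le[OF run \<open>i < m\<close>] w
      by (metis order_trans)
    then show ?thesis using sorted_lower_list[OF sorted_list] that by (simp add: lower_def)
  qed
  moreover have "snd ` set (lower h V w ! i) \<subseteq> {0..1}" if "i < m" for i
    using range_list[OF that] w[OF that] bottom_range[OF run that]
    by (force simp: set_lower_nth[OF that])
  ultimately show ?thesis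
    using k_le_N distinct_lower_nth fst_set_lower_nth
    by (auto simp: is_database_def objects_lower length_lower all_set_conv_all_nth)
qed

interpretation lower: database m k "lower h V w"
  by (standard) (simp_all add: m_pos k_pos is_database_lower)

lemma map_of_lower_V: "i < m \<Longrightarrow> map_of (lower h V w ! i) V = Some (w i)"
  by (rule lower.grade_eq) (auto simp: set_lower_nth)

lemma map_of_lower_other:
  assumes "i < m" "R \<noteq> V"
  shows "map_of (lower h V w ! i) R = map_of (D ! i) R"
proof (cases "R \<in> objects D")
  case True
  then have "(R, grade i R) \<in> set (D ! i)"
    using map_of_grade[OF assms(1)] map_of_SomeD by metis
  then have "(R, grade i R) \<in> set (lower h V w ! i)"
    using assms by (simp add: set_lower_nth)
  then show ?thesis using lower.grade_eq[OF assms(1)] map_of_grade[OF assms(1) True] by simp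
next
  case False
  then show ?thesis
    using objects_list[OF assms(1)] fst_set_lower_nth[OF assms(1)] by (metis map_of_eq_None_iff)
qed

lemma overall_lower_V: "overall t (lower h V w) V = t (map w [0..<m])"
  unfolding lower.overall_eq
  by (rule arg_cong[of _ _ t], rule map_cong) (auto simp: map_of_lower_V)

lemma overall_lower_other: "R \<noteq> V \<Longrightarrow> overall t (lower h V w) R = overall t D R"
  unfolding overall_eq lower.overall_eq
  by (rule arg_cong[of _ _ t], rule map_cong) (auto simp: map_of_lower_other)

text \<open>\<open>A\<close> cannot tell the databases apart: the read prefixes coincide, and
  without wild guesses every random access concerns a seen object, hence not
  \<open>V\<close>.\<close>

lemma run_lower:
  assumes "no_wild_guesses m k A"
  shows "run A (lower h V w) h"
proof (rule run_transfer[OF run, where d = "\<lambda>i. length (sorted_entries h i)"])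
  fix i R x
  assume "RandomEv i R x \<in> set h"
  then have "R \<noteq> V" using no_wild_guesses_random_seen[OF assms db run] V(2) by blast
  then show "lookup_grade (lower h V w) i R = lookup_grade D i R"
    by (simp add: lookup_grade_def length_D length_lower map_of_lower_other)
next
  fix i
  assume i: "i < length D"
  show "length (lower h V w ! i) = length (D ! i)"
    using lower.length_list length_list i by (simp add: length_D objects_lower)
  show "take (length (sorted_entries h i)) (lower h V w ! i) =
      take (length (sorted_entries h i)) (D ! i)"
    using i length_sorted_entries_le_N[OF run, of i] length_list[of i]
    by (simp add: lower_def length_D lower_list_def)
qed (simp_all add: length_D length_lower)

text \<open>\<open>A\<close> gives the same output on both databases, so correctness on the lowered
  one constrains it. If \<open>V\<close> is in the output, its reported grade must be right for
  \<open>w\<close> too.\<close>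

lemma top_lower:
  assumes "correct m k t A" "no_wild_guesses m k A"
    and "A h = Halt ((\<lambda>R. (R, overall t D R)) ` Y)"
  shows "is_top k (objects D) (overall t (lower h V w)) Y"
    and "V \<in> Y \<Longrightarrow> overall t D V = t (map w [0..<m])"
proof -
  let ?g = "overall t (lower h V w)"
  obtain h' Y' where top: "is_top k (objects D) ?g Y'"
    and halts: "halts_with A (lower h V w) h' ((\<lambda>R. (R, ?g R)) ` Y')"
    using assms(1) is_database_lower unfolding correct_def by (metis objects_lower)
  have "halts_with A (lower h V w) h ((\<lambda>R. (R, overall t D R)) ` Y)"
    using run_lower assms by (simp add: halts_with_def)
  from halts_with_unique[OF this halts]
  have eq: "(\<lambda>R. (R, overall t D R)) ` Y = (\<lambda>R. (R, ?g R)) ` Y'" by simp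
  \<comment> \<open>Both outputs are graphs of grade functions, so projecting to objects recovers
    the chosen sets.\<close>
  then have "fst ` (\<lambda>R. (R, overall t D R)) ` Y = fst ` (\<lambda>R. (R, ?g R)) ` Y'" by simp
  then have "Y = Y'" by (simp add: image_image)
  then show "is_top k (objects D) ?g Y" using top by simp
  show "overall t D V = t (map w [0..<m])" if "V \<in> Y"
  proof -
    have "(V, overall t D V) \<in> (\<lambda>R. (R, ?g R)) ` Y'" using eq that by blast
    then show ?thesis using overall_lower_V[of t] by auto
  qed
qed

end

text \<open>\<open>V\<close> may be an unseen object of the output: then its reported grade does not depend on where
  it sits below the read prefixes, so that \<open>t\<close> of the bottom grades is the least value of \<open>t\<close>.\<close>

lemma many_above_bottom:
  assumes "monotone_aggregation m t" "correct m k t A" "no_wild_guesses m k A"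
    and "run A D h" "A h = Halt ((\<lambda>R. (R, overall t D R)) ` Y)"
    and "is_top k (objects D) (overall t D) Y"
    and "card (seen h) + k < N"
  shows "(Y \<subseteq> seen h \<and> (\<forall>R\<in>Y. t (map (bottom h) [0..<m]) \<le> overall t D R)) \<or>
    (\<forall>R\<in>objects D. t (map (bottom h) [0..<m]) \<le> overall t D R)"
proof (cases "Y \<subseteq> seen h")
  case True
  have Y: "finite Y" "card Y = k"
    using assms(6) k_pos card_gt_0_iff unfolding is_top_def by (metis, metis)
  \<comment> \<open>Counting leaves an object outside both \<open>seen h\<close> and the
    output.\<close>
  have "card (seen h \<union> Y) < N"
    using card_Un_le[of "seen h" Y] Y assms(7) by simp
  then have "\<not> objects D \<subseteq> seen h \<union> Y"
    using card_mono[of "seen h \<union> Y" "objects D"] Y finite_card_seen[of h] by auto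
  then obtain V where V: "V \<in> objects D" "V \<notin> seen h" "V \<notin> Y" by blast
  have w: "0 \<le> bottom h i \<and> bottom h i \<le> bottom h i" if "i < m" for i
    using bottom_range[OF assms(4) that] by simp
  note lower = assms(4) V(1,2) w
  have "t (map (bottom h) [0..<m]) \<le> overall t D R" if "R \<in> Y" for R
  proof -
    \<comment> \<open>Since \<open>V\<close> is not output, it is graded no higher than any member
      of \<open>Y\<close>, whose own grade the change leaves alone.\<close>
    have "overall t (lower h V (bottom h)) V \<le> overall t (lower h V (bottom h)) R"
      using top_lower(1)[OF lower assms(2,3,5)] that V unfolding is_top_def by blast
    moreover have "R \<noteq> V" using that V by blast
    ultimately show ?thesis
      using overall_lower_V[OF lower] overall_lower_other[OF lower] by metis
  qed
  then show ?thesis using True by blast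
next
  case False
  then obtain V where V: "V \<in> Y" "V \<notin> seen h" by blast
  then have VD: "V \<in> objects D" using assms(6) by (auto simp: is_top_def)
  have "overall t D V = t (map (bottom h) [0..<m])"
    using bottom_range[OF assms(4)] V
    by (intro top_lower(2)[OF assms(4) VD V(2) _ assms(2,3,5)]) auto
  moreover have "overall t D V = t (map (\<lambda>_. 0) [0..<m])"
    using bottom_range[OF assms(4)] V
    by (intro top_lower(2)[OF assms(4) VD V(2) _ assms(2,3,5)]) auto
  moreover have "t (map (\<lambda>_. 0) [0..<m]) \<le> overall t D R" if "R \<in> objects D" for R
    unfolding overall_eq
    by (rule monotone_aggregation_map[OF assms(1)]) (use grade_range that in auto)
  ultimately show ?thesis by simp
qed

end


subsection \<open>The threshold algorithm\<close>

lemma sorted_entries_map_Random [simp]: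
  "sorted_entries (map (\<lambda>l. RandomEv (f l) (g l) (x l)) ls) i = []"
  by (simp add: sorted_entries_def)

lemma length_filter_neq: "i < m \<Longrightarrow> length (filter (\<lambda>l. l \<noteq> i) [0..<m]) = m - 1"
proof -
  assume "i < m"
  have "length (filter (\<lambda>l. l \<noteq> i) [0..<m]) = card (set (filter (\<lambda>l. l \<noteq> i) [0..<m]))"
    by (rule distinct_card[symmetric]) simp
  also have "set (filter (\<lambda>l. l \<noteq> i) [0..<m]) = {..<m} - {i}" by auto
  also have "card ({..<m} - {i}) = m - 1" using \<open>i < m\<close> by simp
  finally show ?thesis .
qed

locale threshold_run = database m k D for m k and D :: "'o database" +
  fixes t :: "real list \<Rightarrow> real" and pick :: "'o event list \<Rightarrow> 'o set"
  assumes mono: "monotone_aggregation m t" and ties: "tie_breaking m k t pick"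
begin

abbreviation ta :: "'o algorithm" where "ta \<equiv> TA m k t pick"

section \<open>Explicit history of the threshold algorithm\<close>

definition stop :: "'o event list \<Rightarrow> bool" where
  "stop h \<longleftrightarrow> k \<le> card {R \<in> seen h. threshold m t h \<le> computed_grade m t h R}"

definition block :: "nat \<Rightarrow> nat \<Rightarrow> 'o event list" where
  "block q i = SortedEv i (Some (D ! i ! q)) #
     map (\<lambda>l. RandomEv l (fst (D ! i ! q)) (lookup_grade D l (fst (D ! i ! q))))
       (filter (\<lambda>l. l \<noteq> i) [0..<m])"

definition partial_step :: "nat \<Rightarrow> nat \<Rightarrow> 'o event list" where
  "partial_step q i = concat (map (block q) [0..<i])"

text \<open>Defined without regard to the stopping test, so that \<open>stop\<close> can be examined
  at any depth before it is known how far \<open>TA\<close> runs.\<close>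

definition steps :: "nat \<Rightarrow> 'o event list" where
  "steps q = concat (map (\<lambda>p. partial_step p m) [0..<q])"

lemma partial_step_simps [simp]:
  "partial_step q 0 = []" "partial_step q (Suc i) = partial_step q i @ block q i"
  by (simp_all add: partial_step_def)

lemma steps_simps [simp]: "steps 0 = []" "steps (Suc q) = steps q @ partial_step q m"
  by (simp_all add: steps_def)

lemma length_block: "i < m \<Longrightarrow> length (block q i) = m"
  using length_filter_neq[of i m] by (simp add: block_def)

lemma length_partial_step: "i \<le> m \<Longrightarrow> length (partial_step q i) = i * m"
  by (induction i) (auto simp: length_block)

lemma length_steps: "length (steps q) = q * m * m"
  by (induction q) (auto simp: length_partial_step algebra_simps)

lemma filter_block:
  assumes "i < m"
  shows "length (filter is_SortedEv (block q i)) = 1"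
    and "length (filter is_RandomEv (block q i)) = m - 1"
  using length_filter_neq[OF assms] by (simp_all add: block_def filter_map o_def)

lemma filter_partial_step:
  assumes "i \<le> m"
  shows "length (filter is_SortedEv (partial_step q i)) = i"
    and "length (filter is_RandomEv (partial_step q i)) = i * (m - 1)"
  using assms by (induction i) (auto simp: filter_block)

lemma filter_steps:
  "length (filter is_SortedEv (steps q)) = q * m"
  "length (filter is_RandomEv (steps q)) = q * (m * (m - 1))"
  by (induction q) (auto simp: filter_partial_step algebra_simps)

lemma sorted_entries_block: "sorted_entries (block q i) l = (if l = i then [D ! i ! q] else [])"
proof -
  have "sorted_entries (block q i) l = sorted_entries [SortedEv i (Some (D ! i ! q))] l"
    using sorted_entries_append[of "[SortedEv i (Some (D ! i ! q))]"] by (simp add: block_def)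
  then show ?thesis by simp
qed

lemma sorted_entries_partial_step:
  "sorted_entries (partial_step q i) l = (if l < i then [D ! l ! q] else [])"
  by (induction i) (auto simp: sorted_entries_block less_Suc_eq)

text \<open>Beyond \<open>N\<close> entries \<open>D ! l ! q\<close> would be unspecified, hence the
  bound on \<open>q\<close>.\<close>

lemma sorted_entries_steps:
  "q \<le> N \<Longrightarrow> sorted_entries (steps q) l = (if l < m then take q (D ! l) else [])"
  by (induction q) (auto simp: sorted_entries_partial_step length_list take_Suc_conv_app_nth)

section \<open>Agreement of \<open>TA\<close> with the explicit history\<close>

lemma TA_Sorted:
  assumes "length h = (q * m + i) * m" "i < m" "0 < q \<Longrightarrow> i = 0 \<Longrightarrow> \<not> stop h"
  shows "ta h = Sorted i"
  using assms m_pos by (auto simp: TA_def Let_def stop_def)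

text \<open>Offset \<open>0\<close> of a block is its sorted access, so offset \<open>Suc j\<close>
  carries the random access with index \<open>j\<close>.\<close>

lemma TA_Random:
  assumes "length h = (q * m + i) * m + Suc j" "i < m" "Suc j < m"
    and "h ! ((q * m + i) * m) = SortedEv i (Some (R, x))"
  shows "ta h = Random (filter (\<lambda>l. l \<noteq> i) [0..<m] ! j) R"
proof -
  have "length h mod m = Suc j" "length h div m = q * m + i"
    using assms(3) by (simp_all only: assms(1) mod_mult_self3 mod_less div_mult_self3) auto
  then show ?thesis using assms(2,4) by (simp add: TA_def Let_def)
qed

lemma TA_Halt:
  assumes "length h = q * m * m" "0 < q" "stop h"
  shows "ta h = Halt ((\<lambda>R. (R, computed_grade m t h R)) ` pick h)"
  using assms m_pos by (auto simp: TA_def Let_def stop_def)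

text \<open>The test is made only before the first block of a parallel step, and not at the very
  start; hence the premise for \<open>i = 0\<close> and \<open>0 < q\<close>.\<close>

lemma run_block:
  assumes "run ta D (steps q @ partial_step q i)" "q < N" "i < m"
    and "0 < q \<Longrightarrow> i = 0 \<Longrightarrow> \<not> stop (steps q)"
    and "j \<le> m"
  shows "run ta D (steps q @ partial_step q i @ take j (block q i))"
  using assms(5)
proof (induction j)
  case 0
  then show ?case using assms(1) by simp
next
  case (Suc j)
  let ?h = "steps q @ partial_step q i @ take j (block q i)"
  have len: "length (steps q @ partial_step q i) = (q * m + i) * m"
    using assms(3) by (simp add: length_steps length_partial_step algebra_simps)
  have "next_event ta D ?h = Some (block q i ! j)"
  proof (cases j)
    case 0
    have "ta ?h = Sorted i"
      using len 0 assms(4) by (intro TA_Sorted[OF _ assms(3)]) auto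
    moreover have "next_entry D ?h i = Some (D ! i ! q)"
      using 0 assms(2,3)
      by (simp add: next_entry_def sorted_entries_steps sorted_entries_partial_step
          length_D length_list)
    ultimately show ?thesis using 0 by (simp add: next_event_def block_def)
  next
    case (Suc j')
    obtain R x where e: "D ! i ! q = (R, x)" by force
    \<comment> \<open>\<open>TA\<close> reads the object back from the first event of the current
      block.\<close>
    have "?h ! ((q * m + i) * m) = take j (block q i) ! 0"
      using nth_append_length_plus[of "steps q @ partial_step q i" "take j (block q i)" 0]
      unfolding len by simp
    also have "\<dots> = SortedEv i (Some (R, x))"
      using Suc by (simp add: block_def e)
    finally have "ta ?h = Random (filter (\<lambda>l. l \<noteq> i) [0..<m] ! j') R"
      using len Suc Suc.prems assms(3) \<open>Suc j \<le> m\<close> length_block[OF assms(3), of q]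
      by (intro TA_Random[where q = q]) auto
    then show ?thesis
      using Suc \<open>Suc j \<le> m\<close> length_filter_neq[OF assms(3)]
      by (simp add: next_event_def block_def e)
  qed
  then show ?case
    using run_next_event[OF Suc.IH] Suc.prems length_block[OF assms(3), of q]
    by (simp add: take_Suc_conv_app_nth)
qed

lemma run_partial_step:
  assumes "run ta D (steps q)" "q < N" "0 < q \<Longrightarrow> \<not> stop (steps q)" "i \<le> m"
  shows "run ta D (steps q @ partial_step q i)"
  using assms(4)
proof (induction i)
  case (Suc i)
  then show ?case
    using run_block[of q i m] assms(2,3) length_block[of i q] by simp
qed (use assms(1) in simp)

text \<open>Only tests strictly before depth \<open>q\<close> must fail; the one at \<open>q\<close>
  itself may succeed.\<close>

lemma run_steps:
  assumes "\<And>p. 0 < p \<Longrightarrow> p < q \<Longrightarrow> \<not> stop (steps p)" "q \<le> N"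
  shows "run ta D (steps q)"
  using assms
proof (induction q)
  case (Suc q)
  then show ?case using run_partial_step[of q m] by simp
qed (simp add: run.start)

section \<open>Knowledge after complete parallel steps\<close>

lemma seen_steps: "q \<le> N \<Longrightarrow> seen (steps q) = (\<Union>i<m. fst ` set (take q (D ! i)))"
  by (auto simp: seen_eq sorted_entries_steps split: if_splits)

lemma seen_steps_subset:
  assumes "q \<le> N"
  shows "seen (steps q) \<subseteq> objects D"
proof -
  have "fst ` set (take q (D ! i)) \<subseteq> objects D" if "i < m" for i
    using image_mono[OF set_take_subset, of fst q "D ! i"] objects_list[OF that] by simp
  then show ?thesis by (auto simp only: seen_steps[OF assms])
qed

lemma finite_seen_steps: "finite (seen (steps q))"
  by (simp add: finite_card_seen)

text \<open>The first list alone already shows \<open>q\<close> distinct objects.\<close>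

lemma card_seen_steps:
  assumes "q \<le> N"
  shows "q \<le> card (seen (steps q))"
proof -
  have "q = card (fst ` set (take q (D ! 0)))"
    using distinct_card[OF distinct_take[OF distinct_list[OF m_pos]], of q] assms m_pos
    by (simp add: take_map length_list)
  also have "\<dots> \<le> card (seen (steps q))"
    using m_pos assms by (intro card_mono finite_seen_steps) (auto simp: seen_steps)
  finally show ?thesis .
qed

lemma set_steps: "e \<in> set (steps q) \<longleftrightarrow> (\<exists>p<q. \<exists>i<m. e \<in> set (block p i))"
  by (simp add: steps_def partial_step_def Bex_def)

text \<open>Every recorded grade is the true one, and the complete block around a sorted occurrence
  of \<open>R\<close> records its grade in every list, so the description in
  \<open>known_grade\<close> has exactly one solution.\<close>

lemma known_grade_steps:
  assumes "q \<le> N" "R \<in> seen (steps q)" "l < m"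
  shows "known_grade (steps q) R l = grade l R"
proof -
  have R: "R \<in> objects D" using assms seen_steps_subset by blast
  have sound: "x = grade l R"
    if x: "SortedEv l (Some (R, x)) \<in> set (steps q) \<or> RandomEv l R (Some x) \<in> set (steps q)" for x
    using x
  proof
    assume "SortedEv l (Some (R, x)) \<in> set (steps q)"
    then have "(R, x) \<in> set (sorted_entries (steps q) l)" by (simp add: set_sorted_entries)
    then have "(R, x) \<in> set (D ! l)"
      using assms by (auto simp: sorted_entries_steps dest: in_set_takeD)
    then show ?thesis using grade_eq[OF assms(3)] by simp
  next
    assume "RandomEv l R (Some x) \<in> set (steps q)"
    then have "lookup_grade D l R = Some x" by (auto simp: set_steps block_def)
    then show ?thesis using assms(3) by (simp add: lookup_grade_def length_D)
  qed
  obtain i y where "SortedEv i (Some (R, y)) \<in> set (steps q)"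
    using assms(2) by (auto simp: seen_def)
  then obtain p where p: "p < q" "i < m" "D ! i ! p = (R, y)"
    unfolding set_steps by (auto simp: block_def)
  have "SortedEv l (Some (R, grade l R)) \<in> set (steps q) \<or>
      RandomEv l R (Some (grade l R)) \<in> set (steps q)"
  proof (cases "l = i")
    case True
    have "SortedEv i (Some (R, y)) \<in> set (steps q)" by fact
    then show ?thesis using sound[of y] True by blast
  next
    case False
    have "lookup_grade D l R = Some (grade l R)"
      using map_of_grade[OF assms(3) R] assms(3) by (simp add: lookup_grade_def length_D)
    then have "RandomEv l R (Some (grade l R)) \<in> set (block p i)"
      using False assms(3) p(3) by (auto simp: block_def image_iff)
    then show ?thesis using p unfolding set_steps by blast
  qed
  then show ?thesis using sound unfolding known_grade_def by blast
qed

lemma computed_grade_steps: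
  assumes "q \<le> N" "R \<in> seen (steps q)"
  shows "computed_grade m t (steps q) R = overall t D R"
  unfolding computed_grade_def overall_eq
  by (rule arg_cong[of _ _ t], rule map_cong) (auto simp: known_grade_steps[OF assms])

text \<open>The index is \<open>q - 1\<close> since lists start at \<open>0\<close> and
  \<open>q\<close> entries have been read.\<close>

lemma threshold_steps:
  assumes "0 < q" "q \<le> N"
  shows "threshold m t (steps q) = t (map (\<lambda>i. snd (D ! i ! (q - 1))) [0..<m])"
proof -
  have "last (sorted_entries (steps q) i) = D ! i ! (q - 1)" if "i < m" for i
    using that assms length_list[OF that] by (subst last_conv_nth) (auto simp: sorted_entries_steps)
  then show ?thesis unfolding threshold_def
    by (intro arg_cong[of _ _ t] map_cong) auto
qed

lemma threshold_le_overall: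
  assumes "0 < q" "q \<le> N" "R \<in> objects D"
    and "\<And>i. i < m \<Longrightarrow> snd (D ! i ! (q - 1)) \<le> grade i R"
  shows "threshold m t (steps q) \<le> overall t D R"
  unfolding threshold_steps[OF assms(1,2)] overall_eq
  by (rule monotone_aggregation_map[OF mono])
    (use assms snd_nth_range[of _ "q - 1"] grade_range in auto)

text \<open>An unseen object stands below the first \<open>q\<close> entries of every list, so each
  of its grades is at most the last one read there; monotonicity does the rest.\<close>

lemma overall_le_threshold:
  assumes "0 < q" "q \<le> N" "R \<in> objects D" "R \<notin> seen (steps q)"
  shows "overall t D R \<le> threshold m t (steps q)"
  unfolding threshold_steps[OF assms(1,2)] overall_eq
proof (rule monotone_aggregation_map[OF mono], intro conjI)
  fix i
  assume i: "i < m"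
  show "0 \<le> grade i R" using grade_range[OF i assms(3)] by simp
  show "snd (D ! i ! (q - 1)) \<le> 1" using snd_nth_range[OF i] assms(1,2) by simp
  have "(R, grade i R) \<in> set (D ! i)"
    using map_of_SomeD[OF map_of_grade[OF i assms(3)]] .
  then obtain p where p: "p < N" "D ! i ! p = (R, grade i R)"
    by (metis in_set_conv_nth length_list[OF i])
  have "\<not> p < q"
  proof
    assume "p < q"
    then have "(R, grade i R) \<in> set (take q (D ! i))"
      using p length_list[OF i] by (auto simp: in_set_conv_nth intro!: exI[of _ p])
    then have "R \<in> seen (steps q)" using i by (force simp: seen_steps[OF assms(2)])
    then show False using assms(4) by simp
  qed
  then show "grade i R \<le> snd (D ! i ! (q - 1))"
    using nth_antimono[OF i, of "q - 1" p] p by simp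
qed

section \<open>The stopping test\<close>

lemma stop_stepsI:
  assumes "0 < q" "q \<le> N" "Z \<subseteq> seen (steps q)" "k \<le> card Z"
    and "\<And>R. R \<in> Z \<Longrightarrow> threshold m t (steps q) \<le> overall t D R"
  shows "stop (steps q)"
proof -
  have "Z \<subseteq> {R \<in> seen (steps q). threshold m t (steps q) \<le> computed_grade m t (steps q) R}"
    using assms(3,5) computed_grade_steps[OF assms(2)] by auto
  then have "card Z \<le> card {R \<in> seen (steps q).
      threshold m t (steps q) \<le> computed_grade m t (steps q) R}"
    by (intro card_mono) (auto simp: finite_seen_steps)
  then show ?thesis using assms(4) by (simp add: stop_def)
qed

lemma N_pos: "0 < N"
  using k_pos k_le_N by simp

text \<open>At depth \<open>N\<close> the threshold is formed from the least grade of each list, so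
  every object passes.\<close>

lemma stop_steps_N: "stop (steps N)"
proof (rule stop_stepsI[OF N_pos order_refl order_refl])
  show "k \<le> card (seen (steps N))" using card_seen_steps k_le_N order_trans by blast
  fix R
  assume "R \<in> seen (steps N)"
  then have R: "R \<in> objects D" using seen_steps_subset by blast
  have "snd (D ! i ! (N - 1)) \<le> grade i R" if i: "i < m" for i
  proof -
    have "(R, grade i R) \<in> set (D ! i)" using map_of_SomeD[OF map_of_grade[OF i R]] .
    then obtain p where "p < N" "D ! i ! p = (R, grade i R)"
      by (metis in_set_conv_nth length_list[OF i])
    then show ?thesis using nth_antimono[OF i, of p "N - 1"] by simp
  qed
  then show "threshold m t (steps N) \<le> overall t D R"
    using threshold_le_overall[OF N_pos order_refl R] by blast
qed

text \<open>Chosen objects reach the threshold and unseen ones cannot exceed it, so being top among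
  the seen objects means being top among all.\<close>

lemma top_steps:
  assumes "0 < q" "q \<le> N" "stop (steps q)"
  shows "is_top k (objects D) (overall t D) (pick (steps q))"
proof -
  let ?S = "seen (steps q)" and ?Y = "pick (steps q)" and ?c = "computed_grade m t (steps q)"
  let ?G = "{R \<in> ?S. threshold m t (steps q) \<le> ?c R}"
  have G: "k \<le> card ?G" using assms(3) by (simp add: stop_def)
  have "card ?G \<le> card ?S" by (intro card_mono finite_seen_steps) auto
  then have top: "is_top k ?S ?c ?Y" using ties G by (simp add: tie_breaking_def)
  then have Y: "?Y \<subseteq> ?S" "card ?Y = k" "finite ?Y"
    using finite_seen_steps finite_subset by (auto simp: is_top_def)
  have above: "threshold m t (steps q) \<le> ?c R" if R: "R \<in> ?Y" for R
  proof (rule ccontr)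
    assume less: "\<not> threshold m t (steps q) \<le> ?c R"
    \<comment> \<open>An object of \<open>?G\<close> outside \<open>?Y\<close> would be graded above
      \<open>R\<close>, against \<open>top\<close>; so \<open>?G\<close> would have fewer than
      \<open>k\<close> elements.\<close>
    have "?G \<subseteq> ?Y - {R}"
    proof
      fix R'
      assume "R' \<in> ?G"
      then show "R' \<in> ?Y - {R}"
        using top R less unfolding is_top_def by force
    qed
    then have "card ?G \<le> card (?Y - {R})" using Y by (intro card_mono) auto
    then show False using R Y G k_pos by (simp add: card_Diff_singleton)
  qed
  have "overall t D R' \<le> overall t D R" if "R \<in> ?Y" "R' \<in> objects D - ?Y" for R R'
  proof (cases "R' \<in> ?S")
    case True
    then have "?c R' \<le> ?c R" using top that unfolding is_top_def by blast
    then show ?thesis using computed_grade_steps[OF assms(2)] True that Y by force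
  next
    case False
    then show ?thesis
      using overall_le_threshold[OF assms(1,2), of R'] above[OF that(1)] that Y
        computed_grade_steps[OF assms(2), of R] by force
  qed
  then show ?thesis using Y seen_steps_subset[OF assms(2)] by (auto simp: is_top_def)
qed

section \<open>Stopping depth of the threshold algorithm\<close>

definition depth :: nat where
  "depth = (LEAST q. 0 < q \<and> stop (steps q))"

text \<open>\<open>TA\<close> makes no test before the first parallel step, so the minimum is over
  positive depths; \<open>N\<close> witnesses that one exists.\<close>

lemma depth:
  "0 < depth" "stop (steps depth)" "depth \<le> N"
  "0 < p \<Longrightarrow> stop (steps p) \<Longrightarrow> depth \<le> p"
  using LeastI[of "\<lambda>q. 0 < q \<and> stop (steps q)" N]
    Least_le[of "\<lambda>q. 0 < q \<and> stop (steps q)"] stop_steps_N N_pos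
  unfolding depth_def by auto

text \<open>By minimality of \<open>depth\<close> all earlier tests fail, so the run reaches
  \<open>steps depth\<close>; the computed grades of the picked objects are their true
  grades.\<close>

lemma TA_halts_with:
  "halts_with ta D (steps depth) ((\<lambda>R. (R, overall t D R)) ` pick (steps depth))"
proof -
  have "run ta D (steps depth)"
    using run_steps[OF _ depth(3)] depth(4) by (meson not_le)
  moreover have "pick (steps depth) \<subseteq> seen (steps depth)"
  proof -
    have "k \<le> card (seen (steps depth))"
      using depth(2) finite_seen_steps unfolding stop_def
      by (metis (no_types, lifting) card_mono mem_Collect_eq order_trans subsetI)
    then show ?thesis using ties by (auto simp: tie_breaking_def is_top_def)
  qed
  then have "(\<lambda>R. (R, computed_grade m t (steps depth) R)) ` pick (steps depth) =
      (\<lambda>R. (R, overall t D R)) ` pick (steps depth)"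
    using computed_grade_steps[OF depth(3)] by (intro image_cong) auto
  ultimately show ?thesis
    using TA_Halt[OF length_steps depth(1,2)] by (simp add: halts_with_def)
qed

text \<open>The summand \<open>k\<close> serves twice. In a database with more objects than the
  bound, seen and output objects together leave one out; and at this depth \<open>TA\<close> has
  seen at least \<open>k\<close> objects.\<close>

lemma depth_le:
  assumes "correct m k t A" "no_wild_guesses m k A" "halts_with A D h Z"
  shows "depth \<le> length (filter is_SortedEv h) + k"
proof (cases "N \<le> length (filter is_SortedEv h) + k")
  case True
  then show ?thesis using depth(3) by simp
next
  case False
  let ?q = "length (filter is_SortedEv h) + k"
  have q: "0 < ?q" "?q \<le> N" "?q - 1 < N" using False k_pos by auto
  obtain h' Y where Y: "is_top k (objects D) (overall t D) Y"
    and h': "halts_with A D h' ((\<lambda>R. (R, overall t D R)) ` Y)"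
    using assms(1) db unfolding correct_def by blast
  have "h' = h" using halts_with_unique[OF assms(3) h'] by simp
  then have run: "run A D h" and halt: "A h = Halt ((\<lambda>R. (R, overall t D R)) ` Y)"
    using h' by (auto simp: halts_with_def)
  \<comment> \<open>\<open>A\<close> has read no list beyond depth \<open>?q\<close>, so whatever it
    saw is in these steps too.\<close>
  have seen: "seen h \<subseteq> seen (steps ?q)"
  proof -
    have "set (sorted_entries h i) \<subseteq> set (sorted_entries (steps ?q) i)" for i
    proof (cases "i < m")
      case True
      have "sorted_entries h i = take (length (sorted_entries h i)) (D ! i)"
        by (rule sorted_entries_take[OF run True])
      then show ?thesis
        using set_take_subset_set_take[of "length (sorted_entries h i)" ?q "D ! i"] True
          length_sorted_entries_le[of h i] by (simp add: sorted_entries_steps[OF q(2)])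
    next
      case False
      then show ?thesis using run_sorted_entries[OF run, of i] by (simp add: length_D)
    qed
    then show ?thesis unfolding seen_eq by blast
  qed
  \<comment> \<open>Depth \<open>?q\<close> is at least as deep as \<open>A\<close> has read, and
    grades descend; for an unread list the bottom grade is \<open>1\<close>.\<close>
  have threshold: "threshold m t (steps ?q) \<le> t (map (bottom h) [0..<m])"
    unfolding threshold_steps[OF q(1,2)]
  proof (rule monotone_aggregation_map[OF mono], intro conjI)
    fix i
    assume i: "i < m"
    show "0 \<le> snd (D ! i ! (?q - 1))" "bottom h i \<le> 1"
      using snd_nth_range[OF i q(3)] bottom_range[OF run i] by auto
    show "snd (D ! i ! (?q - 1)) \<le> bottom h i"
    proof (cases "sorted_entries h i = []")
      case True
      then show ?thesis using snd_nth_range[OF i q(3)] by (simp add: bottom_def)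
    next
      case False
      have "length (sorted_entries h i) - 1 \<le> ?q - 1"
        using length_sorted_entries_le[of h i] by simp
      then show ?thesis
        using bottom_eq[OF run i False] nth_antimono[OF i _ q(3)] by simp
    qed
  qed
  have few: "card (seen h) + k < N" using finite_card_seen[of h] False by simp
  \<comment> \<open>The witnessing set is the output \<open>Y\<close> in the first case and
    everything seen by depth \<open>?q\<close> in the second.\<close>
  have "stop (steps ?q)"
    using many_above_bottom[OF mono assms(1,2) run halt Y few]
  proof
    assume "Y \<subseteq> seen h \<and> (\<forall>R\<in>Y. t (map (bottom h) [0..<m]) \<le> overall t D R)"
    then show ?thesis
      using Y seen threshold by (intro stop_stepsI[OF q(1,2), of Y]) (force simp: is_top_def)+
  next
    assume "\<forall>R\<in>objects D. t (map (bottom h) [0..<m]) \<le> overall t D R"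
    then show ?thesis
      using card_seen_steps[OF q(2)] seen_steps_subset[OF q(2)] threshold
      by (intro stop_stepsI[OF q(1,2) order_refl]) force+
  qed
  then show ?thesis using depth(4)[OF q(1)] by blast
qed

end

section \<open>Instance optimality\<close>

lemma TA_no_wild_guesses:
  assumes "0 < m"
  shows "no_wild_guesses m k (TA m k t pick)"
proof -
  \<comment> \<open>This holds for arbitrary histories: the object requested is taken from a sorted
    access already recorded.\<close>
  have "R \<in> seen h" if "TA m k t pick h = Random i R" for h :: "'a event list" and i R
  proof -
    let ?b = "length h div m"
    have j: "length h mod m \<noteq> 0" and
      act: "(case h ! (?b * m) of SortedEv _ (Some (R, _)) \<Rightarrow>
          Random (filter (\<lambda>l. l \<noteq> ?b mod m) [0..<m] ! (length h mod m - 1)) R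
        | _ \<Rightarrow> Halt {}) = Random i R"
      using that by (auto simp: TA_def Let_def split: if_splits)
    \<comment> \<open>A nonzero remainder puts the start of the block strictly inside
      \<open>h\<close>.\<close>
    have "?b * m < length h"
      using j div_mult_mod_eq[of "length h" m] by linarith
    then have "h ! (?b * m) \<in> set h" by simp
    moreover obtain l x where "h ! (?b * m) = SortedEv l (Some (R, x))"
      using act by (auto split: event.splits option.splits prod.splits)
    ultimately show ?thesis by (auto simp: seen_def)
  qed
  then show ?thesis by (auto simp: no_wild_guesses_def)
qed

theorem theorem6p1:
  fixes m k :: nat and cS cR :: real
    and t :: "real list \<Rightarrow> real"
    and pick :: "'o event list \<Rightarrow> 'o set"
  assumes "0 < m" and "0 < k" and "0 < cS" and "0 < cR"
    and "aggregation m t" and "monotone_aggregation m t"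
    and "tie_breaking m k t pick"
  shows "instance_optimal cS cR
           {A. correct m k t A \<and> no_wild_guesses m k A}
           {D. is_database m k D}
           (TA m k t pick)"
proof -
  have loc: "threshold_run m k D t pick" if "is_database m k D" for D
    by (intro threshold_run.intro database.intro threshold_run_axioms.intro that assms)
  have "correct m k t (TA m k t pick)"
    unfolding correct_def
  proof (intro allI impI)
    fix D :: "'o database"
    assume "is_database m k D"
    then interpret threshold_run m k D t pick by (rule loc)
    show "\<exists>h Y. is_top k (objects D) (overall t D) Y \<and>
        halts_with ta D h ((\<lambda>R. (R, overall t D R)) ` Y)"
      using TA_halts_with top_steps[OF depth(1,3,2)] by blast
  qed
  \<comment> \<open>\<open>C\<close> is the cost of one parallel step: \<open>m\<close> sorted and
    \<open>m * (m - 1)\<close> random accesses.\<close>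
  moreover define C where "C = real m * cS + real (m * (m - 1)) * cR"
  have "0 \<le> C" using assms by (simp add: C_def)
  \<comment> \<open>If \<open>A\<close> makes \<open>s\<close> sorted accesses, \<open>TA\<close>
    takes at most \<open>s + k\<close> parallel steps. The part \<open>s * C\<close> is charged to
    the sorted accesses of \<open>A\<close> at rate \<open>C / cS\<close>; \<open>k * C\<close> is
    the additive constant.\<close>
  have "cost cS cR (TA m k t pick) D \<le> C / cS * cost cS cR A D + real k * C"
    if A: "correct m k t A" "no_wild_guesses m k A" and D: "is_database m k D" for A D
  proof -
    interpret threshold_run m k D t pick by (rule loc[OF D])
    obtain h Z where h: "halts_with A D h Z"
      using A(1) D unfolding correct_def by blast
    let ?s = "real (length (filter is_SortedEv h))"
    have "cost cS cR ta D = real depth * C"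
      by (simp add: cost_eq[OF TA_halts_with] filter_steps C_def algebra_simps)
    also have "\<dots> \<le> (?s + real k) * C"
      using depth_le[OF A h] \<open>0 \<le> C\<close> by (intro mult_right_mono) linarith+
    also have "\<dots> = C / cS * (?s * cS) + real k * C"
      using assms(3) by (simp add: field_simps)
    \<comment> \<open>Random accesses of \<open>A\<close> can only raise its cost.\<close>
    also have "\<dots> \<le> C / cS * cost cS cR A D + real k * C"
      using assms(3,4) \<open>0 \<le> C\<close> by (intro add_right_mono mult_left_mono) (auto simp: cost_eq[OF h])
    finally show ?thesis .
  qed
  ultimately show ?thesis
    using TA_no_wild_guesses[OF assms(1)] unfolding instance_optimal_def by blast
qed

end
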